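(* Let $A=A^{T}\in\mathbb{R}^{n\times n}$ with eigen-decomposition $A=Q\Lambda Q^{T}$, let $k>0$, $p\ge 0$ be integers with $(p+1)k<n$, and let $m$ be an integer with $m\in[k,k+pk]$. Let $X_0\in\mathbb{R}^{n\times k}$, let $q$ be a positive integer, and let $$X=\rho(A)^{q}X_0=Q\rho(\Lambda)^{q}Q^{T}X_0,$$ where $\rho$ is a polynomial or rational function (defined on the spectrum of $A$) such that $$\min_{1\le j\le k}|\rho(\lambda_j)|=|\rho(\lambda_k)|\ge|\rho(\lambda_{k+1})|\ge\cdots\ge|\rho(\lambda_{m+1})|=\max_{m<j\le n}|\rho(\lambda_j)|.$$ Let $V$, $G$, $G_1$ and $Y$ be constructed from $A$, $X$, $p$, $m$ as described in the context, and suppose that the first $m$ rows of $G$ are linearly independent (the $G_1$-Assumption). Then $$\delta_k(Y)\le c_m\left|\frac{\rho(\lambda_{m+1})}{\rho(\lambda_k)}\right|^{q},\qquad\text{where}\quad c_m=\Gamma_{k,m}(Q^{T}X_0)\,\Gamma_{k,m}(V)\,\left\|G_1^{\dagger}E_k\right\|_2.$$ Moreover, $$\frac{\delta_k(Y)}{\delta_k(X)}\le c'_m\left|\frac{\rho(\lambda_{m+1})}{\rho(\lambda_{k+1})}\right|^{q},\qquad\text{where}\quad c'_m=\frac{\max_{j>m}\|q_j^{T}X_0\|}{\min_{j>k}\|q_j^{T}X_0\|}\,\Gamma_{k,m}(V)\,\left\|G_1^{\dagger}E_k\right\|_2.$$ Here $E_k\in\mathbb{R}^{m\times k}$ consists of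 the first $k$ columns of the $m\times m$ identity matrix.
   Context: Eigen-decomposition: $\Lambda=\mathrm{diag}(\lambda_1,\dots,\lambda_n)$ with $\lambda_1\ge\lambda_2\ge\cdots\ge\lambda_n$, and $Q=[q_1,\dots,q_n]$ is orthogonal with $Aq_i=\lambda_iq_i$. $\rho(\Lambda)=\mathrm{diag}(\rho(\lambda_1),\dots,\rho(\lambda_n))$ and $\rho(A)=Q\rho(\Lambda)Q^T$. $\|\cdot\|$ is the Euclidean norm of a (row) vector, $\|\cdot\|_2$ is the spectral norm of a matrix, and $e_i$ is the $i$-th column of an identity matrix of appropriate size. For $Z\in\mathbb{R}^{n\times k}$, $\displaystyle\delta_k(Z)=\frac{\max_{i>k}\|q_i^TZ\|}{\min_{i\le k}\|q_i^TZ\|}$. For any matrix $M$ with $n$ rows, $\displaystyle\Gamma_{k,m}(M)=\frac{\max_{i>m}\|e_i^TM\|}{\min_{i\le k}\|e_i^TM\|}$. Quotients are understood under the proviso that their denominators are nonzero. Construction. $V\in\mathbb{R}^{n\times(p+1)}$ is the matrix with $i$-th row $(1,\lambda_i,\lambda_i^2,\dots,\lambda_i^p)$. $\mathbf{X}_p=[X\ \ AX\ \cdots\ A^pX]\in\mathbb{R}^{n\times(p+1)k}$. $\hat G=[Q^TX\ \ \Lambda Q^TX\ \cdots\ \Lambda^pQ^TX]$, so that $\mathbf{X}_p=Q\hat G$. $D$ is the $n\times n$ diagonal matrix with $D_{ii}=\|e_i^T\hat G\|=\|q_i^TX\|\,\|e_i^TV\|$. $D^\dagger$ is its pseudo-inverse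 (diagonal, with entry $1/D_{ii}$ if $D_{ii}\ne0$ and $0$ otherwise). $G=D^\dagger\hat G$, so that $\mathbf{X}_p=QDG$. Partition $D=\mathrm{diag}(D_1,D_2)$ with $D_1$ of size $m\times m$, and let $G_1$ be the first $m$ rows of $G$. Under the $G_1$-Assumption, $D_1$ is invertible and the pseudo-inverse $G_1^\dagger$ satisfies $G_1G_1^\dagger=I_{m\times m}$. Define $\mathbf{Y}_p=\mathbf{X}_pG_1^\dagger D_1^{-1}\in\mathbb{R}^{n\times m}$, and let $Y\in\mathbb{R}^{n\times k}$ consist of the first $k$ columns of $\mathbf{Y}_p$. *)

theory Defs
  imports
    Jordan_Normal_Form.Matrix
    Jordan_Normal_Form.Gauss_Jordan_Elimination
    Jordan_Normal_Form.VS_Connect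
    "HOL-Computational_Algebra.Polynomial"
begin

(* Matrices are those of Jordan_Normal_Form, whose rows, columns and entries are indexed from 0:
   the object with index i in the mathematical text has index i - 1 here, so that the index sets
   "i <= k" and "i > k" become {..<k} and {k..<n}. *)

definition euclid_norm :: "real vec \<Rightarrow> real" where
  "euclid_norm v = sqrt (v \<bullet> v)"

definition spectral_norm :: "real mat \<Rightarrow> real" where
  "spectral_norm M =
     (SUP x \<in> {x \<in> carrier_vec (dim_col M). euclid_norm x \<le> 1}. euclid_norm (M *\<^sub>v x))"

(* The four Penrose conditions. *)
definition is_pseudo_inverse :: "real mat \<Rightarrow> real mat \<Rightarrow> bool" where
  "is_pseudo_inverse M B \<longleftrightarrow>
     B \<in> carrier_mat (dim_col M) (dim_row M) \<and>
     M * B * M = M \<and> B * M * B = B \<and>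
     transpose_mat (M * B) = M * B \<and> transpose_mat (B * M) = B * M"

lemma is_pseudo_inverse_unique:
  assumes B: "is_pseudo_inverse M B" and C: "is_pseudo_inverse M C"
  shows "B = C"
proof -
  define r c where "r = dim_row M" and "c = dim_col M"
  have M [simp]: "M \<in> carrier_mat r c" by (auto simp: r_def c_def)
  have Bc [simp]: "B \<in> carrier_mat c r" and Cc [simp]: "C \<in> carrier_mat c r"
    using B C by (auto simp: is_pseudo_inverse_def r_def c_def)
  have [simp]: "M * B \<in> carrier_mat r r" "M * C \<in> carrier_mat r r"
    "B * M \<in> carrier_mat c c" "C * M \<in> carrier_mat c c"
    using M Bc Cc mult_carrier_mat by blast+
  have MB: "M * B = M * C"
  proof -
    have "M * B = (M * C * M) * B" using C by (simp add: is_pseudo_inverse_def)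
    also have "\<dots> = (M * C) * (M * B)"
      by (rule assoc_mult_mat[of _ r r _ c _ r]) auto
    finally have "M * B = transpose_mat ((M * C) * (M * B))"
      using B by (simp add: is_pseudo_inverse_def)
    also have "\<dots> = transpose_mat (M * B) * transpose_mat (M * C)"
      by (rule transpose_mult[of _ r r _ r]) auto
    also have "\<dots> = (M * B) * (M * C)" using B C by (simp add: is_pseudo_inverse_def)
    also have "\<dots> = (M * B * M) * C"
      by (rule assoc_mult_mat[of _ r r _ c _ r, symmetric]) auto
    finally show ?thesis using B by (simp add: is_pseudo_inverse_def)
  qed
  have BM: "B * M = C * M"
  proof -
    have "B * M = B * (M * C * M)" using C by (simp add: is_pseudo_inverse_def)
    also have "\<dots> = B * (M * (C * M))"
      by (subst assoc_mult_mat[of M r c C r M c]) auto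
    also have "\<dots> = (B * M) * (C * M)"
      by (rule assoc_mult_mat[of _ c r _ c _ c, symmetric]) auto
    finally have "B * M = transpose_mat ((B * M) * (C * M))"
      using B by (simp add: is_pseudo_inverse_def)
    also have "\<dots> = transpose_mat (C * M) * transpose_mat (B * M)"
      by (rule transpose_mult[of _ c c _ c]) auto
    also have "\<dots> = (C * M) * (B * M)" using B C by (simp add: is_pseudo_inverse_def)
    also have "\<dots> = C * (M * (B * M))"
      by (rule assoc_mult_mat[of _ c r _ c _ c]) auto
    also have "\<dots> = C * (M * B * M)"
      by (subst assoc_mult_mat[of M r c B r M c]) auto
    finally show ?thesis using B by (simp add: is_pseudo_inverse_def)
  qed
  have "B = (B * M) * B" using B by (simp add: is_pseudo_inverse_def)
  also have "\<dots> = C * (M * B)" unfolding BM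
    by (rule assoc_mult_mat[of _ c r _ c _ r]) auto
  also have "\<dots> = (C * M) * C" unfolding MB
    by (rule assoc_mult_mat[of _ c r _ c _ r, symmetric]) auto
  finally show ?thesis using C by (simp add: is_pseudo_inverse_def)
qed

definition pseudo_inverse :: "real mat \<Rightarrow> real mat" where
  "pseudo_inverse M = (THE B. is_pseudo_inverse M B)"

definition diag_pseudo_inverse :: "real mat \<Rightarrow> real mat" where
  "diag_pseudo_inverse D =
     mat_diag (dim_row D) (\<lambda>i. if D $$ (i, i) \<noteq> 0 then 1 / D $$ (i, i) else 0)"

definition first_rows :: "nat \<Rightarrow> real mat \<Rightarrow> real mat" where
  "first_rows m M = mat m (dim_col M) (\<lambda>(i, j). M $$ (i, j))"

definition first_cols :: "nat \<Rightarrow> real mat \<Rightarrow> real mat" where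
  "first_cols k M = mat (dim_row M) k (\<lambda>(i, j). M $$ (i, j))"

(* Linear independence of the rows as a family; the library notion is about sets of vectors,
   hence the distinctness. *)
definition rows_lin_indpt :: "real mat \<Rightarrow> bool" where
  "rows_lin_indpt M \<longleftrightarrow>
     distinct (rows M) \<and>
     \<not> module.lin_dep class_ring (module_vec TYPE(real) (dim_col M)) (set (rows M))"

(* The block matrix [Z, B Z, ..., B^p Z]: for Z with k columns, column l * k + j is column j
   of B^l Z. *)
definition block_krylov :: "real mat \<Rightarrow> real mat \<Rightarrow> nat \<Rightarrow> real mat" where
  "block_krylov B Z p =
     mat (dim_row Z) ((p + 1) * dim_col Z)
       (\<lambda>(i, j). (B ^\<^sub>m (j div dim_col Z) * Z) $$ (i, j mod dim_col Z))"

definition vandermonde :: "nat \<Rightarrow> nat \<Rightarrow> (nat \<Rightarrow> real) \<Rightarrow> real mat" where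
  "vandermonde n p lam = mat n (p + 1) (\<lambda>(i, j). lam i ^ j)"

definition row_norm_diag :: "real mat \<Rightarrow> real mat" where
  "row_norm_diag M = mat_diag (dim_row M) (\<lambda>i. euclid_norm (row M i))"

(* The Euclidean norm of the row vector q_i^T Z, q_i being column i of Q; as a (column) vector
   it is Z^T q_i. *)
definition qnorm :: "real mat \<Rightarrow> real mat \<Rightarrow> nat \<Rightarrow> real" where
  "qnorm Q Z i = euclid_norm (transpose_mat Z *\<^sub>v col Q i)"

definition delta :: "real mat \<Rightarrow> nat \<Rightarrow> real mat \<Rightarrow> real" where
  "delta Q k Z = (MAX i \<in> {k..<dim_row Z}. qnorm Q Z i) / (MIN i \<in> {..<k}. qnorm Q Z i)"

definition Gamma_ratio :: "nat \<Rightarrow> nat \<Rightarrow> real mat \<Rightarrow> real" where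
  "Gamma_ratio k m M =
     (MAX i \<in> {m..<dim_row M}. euclid_norm (row M i)) / (MIN i \<in> {..<k}. euclid_norm (row M i))"

end

theory Submission
  imports
    Defs
    "HOL-Analysis.L2_Norm"
    Jordan_Normal_Form.DL_Rank
begin

text \<open>
  Write \<open>H = Q\<^sup>T X\<^sub>p = D G\<close>. Since \<open>G\<^sub>1 G\<^sub>1\<^sup>\<dagger> = I\<close>, the first \<open>m\<close> rows of \<open>Q\<^sup>T Y = H G\<^sub>1\<^sup>\<dagger> D\<^sub>1\<^sup>-\<^sup>1 E\<^sub>k\<close>
  are the rows of \<open>E\<^sub>k\<close>: this makes the denominator of \<open>\<delta>\<^sub>k(Y)\<close> equal to 1 and removes the rows
  between \<open>k\<close> and \<open>m\<close> from its numerator. Any other row has norm at most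
  \<open>D\<^sub>i\<^sub>i \<parallel>G\<^sub>1\<^sup>\<dagger> E\<^sub>k\<parallel> / min\<^sub>j\<^sub>\<le>\<^sub>k D\<^sub>j\<^sub>j\<close>, because \<open>D\<^sub>1\<^sup>-\<^sup>1\<close> is diagonal and the rows of \<open>G\<close> are normalised.
  The factorisation \<open>D\<^sub>i\<^sub>i = |\<rho>(\<lambda>\<^sub>i)|\<^sup>q \<parallel>q\<^sub>i\<^sup>T X\<^sub>0\<parallel> \<parallel>e\<^sub>i\<^sup>T V\<parallel>\<close> then separates the powers of \<open>\<rho>\<close>
  from the constants.
\<close>

section \<open>Euclidean and spectral norms\<close>

lemma euclid_norm_eq_L2_set: "euclid_norm v = L2_set (\<lambda>i. v $ i) {..<dim_vec v}"
  by (simp add: euclid_norm_def L2_set_def scalar_prod_def power2_eq_square atLeast0LessThan)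

lemma euclid_norm_nonneg [simp]: "0 \<le> euclid_norm v"
  by (simp add: euclid_norm_eq_L2_set)

lemma euclid_norm_square: "(euclid_norm v)\<^sup>2 = v \<bullet> v"
  by (simp add: euclid_norm_def scalar_prod_def sum_nonneg)

lemma euclid_norm_eq_0_iff: "euclid_norm v = 0 \<longleftrightarrow> v = 0\<^sub>v (dim_vec v)"
  by (auto simp: euclid_norm_eq_L2_set L2_set_eq_0_iff intro!: eq_vecI)
    (metis index_zero_vec(1))

lemma euclid_norm_smult: "euclid_norm (a \<cdot>\<^sub>v v) = \<bar>a\<bar> * euclid_norm v"
  by (simp add: euclid_norm_def real_sqrt_mult flip: mult.assoc)

lemma euclid_norm_unit_vec: "i < n \<Longrightarrow> euclid_norm (unit_vec n i) = 1"
  by (simp add: euclid_norm_def)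

lemma euclid_norm_mono:
  assumes "dim_vec v = dim_vec w" and "\<And>i. i < dim_vec v \<Longrightarrow> \<bar>v $ i\<bar> \<le> \<bar>w $ i\<bar>"
  shows "euclid_norm v \<le> euclid_norm w"
proof -
  have "L2_set (\<lambda>i. \<bar>v $ i\<bar>) {..<dim_vec v} \<le> L2_set (\<lambda>i. \<bar>w $ i\<bar>) {..<dim_vec v}"
    using assms by (intro L2_set_mono) auto
  then show ?thesis using assms(1) by (simp add: euclid_norm_eq_L2_set L2_set_def)
qed

lemma abs_scalar_prod_le:
  assumes "dim_vec v = dim_vec w"
  shows "\<bar>v \<bullet> w\<bar> \<le> euclid_norm v * euclid_norm w"
proof -
  have "\<bar>v \<bullet> w\<bar> \<le> (\<Sum>i<dim_vec w. \<bar>v $ i\<bar> * \<bar>w $ i\<bar>)"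
    unfolding scalar_prod_def atLeast0LessThan by (rule order_trans[OF sum_abs]) (simp add: abs_mult)
  also have "\<dots> \<le> euclid_norm v * euclid_norm w"
    using L2_set_mult_ineq[of "\<lambda>i. v $ i" "\<lambda>i. w $ i" "{..<dim_vec w}"] assms
    by (simp add: euclid_norm_eq_L2_set)
  finally show ?thesis .
qed

text \<open>The supremum defining \<open>spectral_norm\<close> is meaningful only over a bounded
  set. Cauchy-Schwarz in each row gives the crude bound used here, the sum of the row norms.\<close>

lemma bdd_above_spectral_norm:
  "bdd_above ((\<lambda>x. euclid_norm (M *\<^sub>v x)) ` {x \<in> carrier_vec (dim_col M). euclid_norm x \<le> 1})"
proof (rule bdd_aboveI2)
  fix x assume x: "x \<in> {x \<in> carrier_vec (dim_col M). euclid_norm x \<le> 1}"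
  have "euclid_norm (M *\<^sub>v x) \<le> (\<Sum>i<dim_row M. \<bar>(M *\<^sub>v x) $ i\<bar>)"
    unfolding euclid_norm_eq_L2_set by (rule order_trans[OF L2_set_le_sum_abs]) simp
  also have "\<dots> \<le> (\<Sum>i<dim_row M. euclid_norm (row M i))"
  proof (rule sum_mono)
    fix i assume i: "i \<in> {..<dim_row M}"
    have "\<bar>row M i \<bullet> x\<bar> \<le> euclid_norm (row M i) * euclid_norm x"
      by (rule abs_scalar_prod_le) (use x in auto)
    also have "\<dots> \<le> euclid_norm (row M i)"
      using x by (intro mult_right_le_one_le) (auto simp: euclid_norm_eq_L2_set)
    finally show "\<bar>(M *\<^sub>v x) $ i\<bar> \<le> euclid_norm (row M i)" using i by simp
  qed
  finally show "euclid_norm (M *\<^sub>v x) \<le> (\<Sum>i<dim_row M. euclid_norm (row M i))" .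
qed

lemma spectral_norm_nonneg: "0 \<le> spectral_norm M"
proof -
  have "euclid_norm (M *\<^sub>v 0\<^sub>v (dim_col M)) \<le> spectral_norm M"
    unfolding spectral_norm_def
    by (rule cSUP_upper[OF _ bdd_above_spectral_norm]) (simp add: euclid_norm_def)
  then show ?thesis by (rule order_trans[OF euclid_norm_nonneg])
qed

lemma euclid_norm_mult_mat_vec_le:
  assumes x: "x \<in> carrier_vec (dim_col M)"
  shows "euclid_norm (M *\<^sub>v x) \<le> spectral_norm M * euclid_norm x"
proof (cases "euclid_norm x = 0")
  case True
  then have "x = 0\<^sub>v (dim_col M)" using x by (metis carrier_vecD euclid_norm_eq_0_iff)
  then have "M *\<^sub>v x = 0\<^sub>v (dim_row M)" by (auto intro!: eq_vecI)
  then show ?thesis using True by (simp add: euclid_norm_def)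
next
  case False
  define a where "a = 1 / euclid_norm x"
  have pos: "euclid_norm x > 0" using False by (simp add: less_le)
  have "euclid_norm (M *\<^sub>v (a \<cdot>\<^sub>v x)) \<le> spectral_norm M"
    unfolding spectral_norm_def
    by (rule cSUP_upper[OF _ bdd_above_spectral_norm])
      (use x pos in \<open>simp add: euclid_norm_smult a_def\<close>)
  also have "M *\<^sub>v (a \<cdot>\<^sub>v x) = a \<cdot>\<^sub>v (M *\<^sub>v x)"
    using x by (intro mult_mat_vec) auto
  finally show ?thesis using pos by (simp add: euclid_norm_smult a_def field_simps)
qed

text \<open>A duality argument replaces singular values: for w = M^T z one has |w|^2 = z . M w <=
  |z| ||M|| |w|, and |w| cancels. This form is the one needed for row vectors acting on
  \<open>M\<close> from the left.\<close>

lemma euclid_norm_transpose_mult_mat_vec_le: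
  assumes z: "z \<in> carrier_vec (dim_row M)"
  shows "euclid_norm (transpose_mat M *\<^sub>v z) \<le> spectral_norm M * euclid_norm z"
proof (cases "euclid_norm (transpose_mat M *\<^sub>v z) = 0")
  case True
  then show ?thesis by (simp add: spectral_norm_nonneg)
next
  case False
  define w where "w = transpose_mat M *\<^sub>v z"
  have w: "w \<in> carrier_vec (dim_col M)" by (auto simp: w_def intro!: carrier_vecI)
  have pos: "euclid_norm w > 0" using False by (simp add: less_le w_def)
  have "(euclid_norm w)\<^sup>2 = z \<bullet> (M *\<^sub>v w)"
    using transpose_vec_mult_scalar[OF _ w z] by (simp add: euclid_norm_square w_def)
  also have "\<dots> \<le> euclid_norm z * euclid_norm (M *\<^sub>v w)"
    using abs_scalar_prod_le[of z "M *\<^sub>v w"] z by simp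
  also have "\<dots> \<le> euclid_norm z * (spectral_norm M * euclid_norm w)"
    by (intro mult_left_mono euclid_norm_mult_mat_vec_le w) simp
  finally show ?thesis using pos by (simp add: power2_eq_square w_def mult_ac)
qed

section \<open>Pseudo-inverse of a matrix with independent rows\<close>

lemma mult_pseudo_inverse_right:
  assumes M: "M \<in> carrier_mat r c" and "rows_lin_indpt M"
  shows "M * pseudo_inverse M = 1\<^sub>m r" and "pseudo_inverse M \<in> carrier_mat c r"
proof -
  let ?T = "transpose_mat M"
  have T: "?T \<in> carrier_mat c r" and MT: "M * ?T \<in> carrier_mat r r" using M by auto
  \<comment> \<open>Independence of the rows as a family amounts to injectivity of the
    transpose.\<close>
  have inj: "v = 0\<^sub>v r" if v: "v \<in> carrier_vec r" "?T *\<^sub>v v = 0\<^sub>v c" for v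
    using vec_space.lin_depI[OF T v(1) _ v(2)] assms by (auto simp: rows_lin_indpt_def)
  \<comment> \<open>The Gram matrix M M^T is nonsingular: a kernel vector v satisfies |M^T v|^2 = v
    . M M^T v = 0, which contradicts injectivity.\<close>
  have "det (M * ?T) \<noteq> 0"
  proof
    assume "det (M * ?T) = 0"
    then obtain v where v: "v \<in> carrier_vec r" "v \<noteq> 0\<^sub>v r" "(M * ?T) *\<^sub>v v = 0\<^sub>v r"
      using det_0_iff_vec_prod_zero[OF MT] by auto
    have "(euclid_norm (?T *\<^sub>v v))\<^sup>2 = v \<bullet> (M *\<^sub>v (?T *\<^sub>v v))"
      unfolding euclid_norm_square
      using transpose_vec_mult_scalar[OF M _ v(1), of "?T *\<^sub>v v"] T v(1) by simp
    also have "M *\<^sub>v (?T *\<^sub>v v) = 0\<^sub>v r"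
      using v assoc_mult_mat_vec[OF M T v(1)] by simp
    finally have "euclid_norm (?T *\<^sub>v v) = 0" using v(1) by simp
    then show False using inj v T by (auto simp: euclid_norm_eq_0_iff)
  qed
  from det_non_zero_imp_unit[OF MT this, of "()"]
  obtain S where S: "S \<in> carrier_mat r r" "M * ?T * S = 1\<^sub>m r"
    by (auto simp: Units_def ring_mat_def)
  \<comment> \<open>The closed form M^T (M M^T)^-1 for full row rank; checking the Penrose
    conditions on it supplies the existence that the \<open>THE\<close> in
    \<open>pseudo_inverse\<close> requires.\<close>
  define B where "B = ?T * S"
  have B: "B \<in> carrier_mat c r" using T S by (auto simp: B_def)
  have MB: "M * B = 1\<^sub>m r" using S assoc_mult_mat[OF M T S(1)] by (simp add: B_def)
  \<comment> \<open>Transposing the equation for the right inverse \<open>S\<close> of a symmetric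
    matrix makes S^T a left inverse. The two must agree, so \<open>S\<close> is symmetric, and hence
    so is B M = M^T S M.\<close>
  have "transpose_mat S * (M * ?T) = 1\<^sub>m r"
  proof -
    have "transpose_mat (M * ?T * S) = transpose_mat S * transpose_mat (M * ?T)"
      by (rule transpose_mult[OF MT S(1)])
    also have "transpose_mat (M * ?T) = M * ?T"
      using transpose_mult[OF M T] by simp
    finally show ?thesis using S by simp
  qed
  then have "transpose_mat S * (M * ?T) * S = S" using S by simp
  moreover have "transpose_mat S * (M * ?T) * S = transpose_mat S * (M * ?T * S)"
    using S MT by (intro assoc_mult_mat) auto
  ultimately have S_sym: "transpose_mat S = S" using S by simp
  have "transpose_mat (B * M) = B * M"
  proof -
    have "transpose_mat (B * M) = ?T * transpose_mat B" by (rule transpose_mult[OF B M])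
    also have "transpose_mat B = S * M" using transpose_mult[OF T S(1)] by (simp add: B_def S_sym)
    also have "?T * (S * M) = B * M" using assoc_mult_mat[OF T S(1) M] by (simp add: B_def)
    finally show ?thesis .
  qed
  moreover have "B * M * B = B" using assoc_mult_mat[OF B M B] B by (simp add: MB)
  ultimately have "is_pseudo_inverse M B"
    using M B by (simp add: is_pseudo_inverse_def MB)
  then have "pseudo_inverse M = B"
    unfolding pseudo_inverse_def by (intro the_equality is_pseudo_inverse_unique)
  then show "M * pseudo_inverse M = 1\<^sub>m r" and "pseudo_inverse M \<in> carrier_mat c r"
    using MB B by auto
qed

text \<open>A zero row of \<open>M\<close> would put a zero on the diagonal of
  \<open>M * pseudo_inverse M\<close>, which is the identity.\<close>

lemma rows_lin_indpt_row_nonzero: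
  assumes "rows_lin_indpt M" and i: "i < dim_row M"
  shows "row M i \<noteq> 0\<^sub>v (dim_col M)"
proof
  assume 0: "row M i = 0\<^sub>v (dim_col M)"
  have "(M * pseudo_inverse M) $$ (i, i) = 1"
    using mult_pseudo_inverse_right(1)[OF _ assms(1), of "dim_row M" "dim_col M"] i by auto
  moreover have "(M * pseudo_inverse M) $$ (i, i) = 0"
    using mult_pseudo_inverse_right(2)[OF _ assms(1), of "dim_row M" "dim_col M"] i 0
    by (auto simp: scalar_prod_def)
  ultimately show False by simp
qed

section \<open>Block Krylov matrices in eigenvector coordinates\<close>

lemma pow_mat_intertwine:
  fixes B C P :: "'a :: comm_semiring_1 mat"
  assumes B: "B \<in> carrier_mat n n" and C: "C \<in> carrier_mat r r" and P: "P \<in> carrier_mat r n"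
    and PB: "P * B = C * P"
  shows "P * B ^\<^sub>m l = C ^\<^sub>m l * P"
proof (induction l)
  case 0
  then show ?case using B C P by simp
next
  case (Suc l)
  have "P * B ^\<^sub>m Suc l = (P * B ^\<^sub>m l) * B"
    using assoc_mult_mat[OF P pow_carrier_mat[OF B] B] by simp
  also have "\<dots> = C ^\<^sub>m l * (P * B)"
    unfolding Suc by (rule assoc_mult_mat[OF pow_carrier_mat[OF C] P B])
  also have "\<dots> = C ^\<^sub>m Suc l * P"
    unfolding PB using assoc_mult_mat[OF pow_carrier_mat[OF C] C P] by simp
  finally show ?case .
qed

lemma mat_diag_pow: "mat_diag n f ^\<^sub>m l = mat_diag n (\<lambda>i. f i ^ l)"
proof (induction l)
  case 0
  show ?case by (simp add: mat_diag_def)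
next
  case (Suc l)
  then show ?case by (simp add: power_commutes)
qed

lemma block_krylov_intertwine:
  assumes B: "B \<in> carrier_mat n n" and C: "C \<in> carrier_mat r r" and P: "P \<in> carrier_mat r n"
    and PB: "P * B = C * P" and Z: "Z \<in> carrier_mat n k"
  shows "P * block_krylov B Z p = block_krylov C (P * Z) p"
proof (rule eq_matI)
  fix i j assume "i < dim_row (block_krylov C (P * Z) p)" "j < dim_col (block_krylov C (P * Z) p)"
  then have i: "i < r" and j: "j < (p + 1) * k" using P Z by (auto simp: block_krylov_def)
  define l where "l = j div k"
  \<comment> \<open>The bound on \<open>j\<close> excludes \<open>k = 0\<close>, where
    \<open>j mod k\<close> would be \<open>j\<close>.\<close>
  have k: "j mod k < k" using j by (cases "k = 0") auto
  have "P * (B ^\<^sub>m l * Z) = (P * B ^\<^sub>m l) * Z"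
    using P B Z by (intro assoc_mult_mat[symmetric]) auto
  also have "\<dots> = C ^\<^sub>m l * (P * Z)"
    unfolding pow_mat_intertwine[OF B C P PB] using P C Z by (intro assoc_mult_mat) auto
  finally have "(C ^\<^sub>m l * (P * Z)) $$ (i, j mod k) = (P * (B ^\<^sub>m l * Z)) $$ (i, j mod k)"
    by simp
  also have "\<dots> = row P i \<bullet> col (B ^\<^sub>m l * Z) (j mod k)"
    using i k P B Z by (intro index_mult_mat) auto
  also have "col (B ^\<^sub>m l * Z) (j mod k) = col (block_krylov B Z p) j"
    using j k Z B by (intro eq_vecI) (auto simp: block_krylov_def l_def)
  finally show "(P * block_krylov B Z p) $$ (i, j) = block_krylov C (P * Z) p $$ (i, j)"
    using i j k P Z C B by (simp add: block_krylov_def l_def)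
qed (use P Z in \<open>auto simp: block_krylov_def\<close>)

lemma block_krylov_diag_index:
  assumes W: "W \<in> carrier_mat n k" and i: "i < n" and j: "j < (p + 1) * k"
  shows "block_krylov (mat_diag n f) W p $$ (i, j) = f i ^ (j div k) * W $$ (i, j mod k)"
proof -
  have "j mod k < k" using j by (cases "k = 0") auto
  then show ?thesis
    using i j W by (simp add: block_krylov_def mat_diag_pow mat_diag_mult_left[OF W])
qed

text \<open>Row i of block l is \<open>f i ^ l\<close> times row i of \<open>W\<close>. Grouping the
  squared entries by blocks gives a double sum over l and the position in the block, and this sum
  factors. It is the identity D_ii = |q_i^T X| |e_i^T V|.\<close>

lemma euclid_norm_row_block_krylov_diag:
  assumes W: "W \<in> carrier_mat n k" and i: "i < n"
  shows "euclid_norm (row (block_krylov (mat_diag n f) W p) i)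
       = euclid_norm (row W i) * euclid_norm (row (vandermonde n p f) i)"
proof -
  let ?g = "\<lambda>j. (f i ^ (j div k) * W $$ (i, j mod k))\<^sup>2"
  have "(\<Sum>j<(p + 1) * k. ?g j) = (\<Sum>l<p + 1. \<Sum>j = l * k..<l * k + k. ?g j)"
    by (simp only: sum.nat_group)
  also have "\<dots> = (\<Sum>l<p + 1. \<Sum>j<k. ?g (l * k + j))"
    by (subst sum.atLeastLessThan_shift_0) (simp add: atLeast0LessThan)
  also have "\<dots> = (\<Sum>l<p + 1. \<Sum>j<k. (f i ^ l)\<^sup>2 * (W $$ (i, j))\<^sup>2)"
    by (intro sum.cong refl) (auto simp: power_mult_distrib)
  also have "\<dots> = (\<Sum>l<p + 1. (f i ^ l)\<^sup>2) * (\<Sum>j<k. (W $$ (i, j))\<^sup>2)"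
    by (simp only: sum_product)
  finally have sums: "(\<Sum>j<(p + 1) * k. ?g j)
    = (\<Sum>l<p + 1. (f i ^ l)\<^sup>2) * (\<Sum>j<k. (W $$ (i, j))\<^sup>2)" .
  let ?H = "block_krylov (mat_diag n f) W p"
  have dim: "dim_row ?H = n" "dim_col ?H = (p + 1) * k" using W by (simp_all add: block_krylov_def)
  have "euclid_norm (row ?H i) = sqrt (\<Sum>j<(p + 1) * k. ?g j)"
    unfolding euclid_norm_eq_L2_set L2_set_def
    using i by (intro arg_cong[of _ _ sqrt] sum.cong) (simp_all add: dim block_krylov_diag_index[OF W i])
  also have "\<dots> = sqrt (\<Sum>j<k. (W $$ (i, j))\<^sup>2) * sqrt (\<Sum>l<p + 1. (f i ^ l)\<^sup>2)"
    unfolding sums by (simp only: real_sqrt_mult mult.commute)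
  also have "sqrt (\<Sum>j<k. (W $$ (i, j))\<^sup>2) = euclid_norm (row W i)"
    using W i by (simp add: euclid_norm_eq_L2_set L2_set_def)
  also have "sqrt (\<Sum>l<p + 1. (f i ^ l)\<^sup>2) = euclid_norm (row (vandermonde n p f) i)"
    unfolding euclid_norm_eq_L2_set L2_set_def
    using i by (intro arg_cong[of _ _ sqrt] sum.cong) (simp_all add: vandermonde_def)
  finally show ?thesis .
qed

section \<open>Eigenvector coordinates, diagonal inverses and ratios of row norms\<close>

lemma qnorm_eq:
  assumes Q: "Q \<in> carrier_mat n r" and Z: "Z \<in> carrier_mat n k" and i: "i < r"
  shows "qnorm Q Z i = euclid_norm (row (transpose_mat Q * Z) i)"
proof -
  have "transpose_mat Z *\<^sub>v col Q i = row (transpose_mat Q * Z) i"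
    using Q Z i by (intro eq_vecI) (auto intro!: comm_scalar_prod[of _ n])
  then show ?thesis by (simp add: qnorm_def)
qed

text \<open>The explicit two-sided inverse first rules out the outcome \<open>None\<close>, on which
  \<open>the\<close> is unspecified; uniqueness of inverses then identifies the result.\<close>

lemma mat_inverse_diag:
  assumes "\<And>i. i < n \<Longrightarrow> d i \<noteq> (0 :: 'a :: field)"
  shows "the (mat_inverse (mat_diag n d)) = mat_diag n (\<lambda>i. 1 / d i)"
proof -
  let ?D = "mat_diag n d" and ?E = "mat_diag n (\<lambda>i. 1 / d i)"
  have DE: "?D * ?E = 1\<^sub>m n" and ED: "?E * ?D = 1\<^sub>m n"
    using assms by (auto simp: mat_diag_mult_left[OF mat_diag_dim] intro!: eq_matI)
      (auto simp: mat_diag_def)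
  then have "?D \<in> Units (ring_mat TYPE('a) n ())"
    by (auto simp: Units_def ring_mat_def intro!: bexI[of _ ?E])
  then obtain B where B: "mat_inverse ?D = Some B"
    using mat_inverse(1)[of ?D n "()"] by (cases "mat_inverse ?D") auto
  from mat_inverse(2)[OF mat_diag_dim B] have BD: "B * ?D = 1\<^sub>m n" "B \<in> carrier_mat n n" by auto
  have "B = B * (?D * ?E)" unfolding DE using BD by simp
  also have "\<dots> = (B * ?D) * ?E"
    by (rule assoc_mult_mat[OF BD(2) mat_diag_dim mat_diag_dim, symmetric])
  also have "\<dots> = ?E" by (simp only: BD(1) left_mult_one_mat[OF mat_diag_dim])
  finally show ?thesis by (simp add: B)
qed

lemma first_cols_mult:
  assumes "M \<in> carrier_mat r c" "N \<in> carrier_mat c n" "k \<le> n"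
  shows "M * first_cols k N = first_cols k (M * N)"
  using assms by (intro eq_matI) (auto simp: first_cols_def scalar_prod_def)

text \<open>Each row norm is a product of nonnegative factors, so its maximum is at most the product
  of the maxima and its minimum at least the product of the minima. Equality can fail because the
  extremes may occur in different rows. Positivity in the first \<open>k\<close> rows keeps the
  smaller denominator positive.\<close>

lemma Gamma_ratio_block_krylov:
  assumes W: "W \<in> carrier_mat n k'" and k: "0 < k" "k \<le> n" and m: "m < n"
    and pos: "\<And>i. i < k \<Longrightarrow> 0 < euclid_norm (row W i)"
    and posV: "\<And>i. i < k \<Longrightarrow> 0 < euclid_norm (row (vandermonde n p f) i)"
  shows "Gamma_ratio k m (block_krylov (mat_diag n f) W p)
       \<le> Gamma_ratio k m W * Gamma_ratio k m (vandermonde n p f)"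
proof -
  let ?w = "\<lambda>i. euclid_norm (row W i)" and ?v = "\<lambda>i. euclid_norm (row (vandermonde n p f) i)"
  have eq: "euclid_norm (row (block_krylov (mat_diag n f) W p) i) = ?w i * ?v i" if "i < n" for i
    by (rule euclid_norm_row_block_krylov_diag[OF W that])
  have max: "(MAX i\<in>{m..<n}. ?w i * ?v i) \<le> (MAX i\<in>{m..<n}. ?w i) * (MAX i\<in>{m..<n}. ?v i)"
    using m by (subst Max_le_iff)
      (auto intro!: mult_mono Max_ge order_trans[OF euclid_norm_nonneg Max_ge])
  have min: "(MIN i\<in>{..<k}. ?w i) * (MIN i\<in>{..<k}. ?v i) \<le> (MIN i\<in>{..<k}. ?w i * ?v i)"
    using k by (subst Min_ge_iff) (auto intro!: mult_mono Min_le Min.boundedI)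
  have "0 < (MIN i\<in>{..<k}. ?w i) * (MIN i\<in>{..<k}. ?v i)"
    using k pos posV by (intro mult_pos_pos) (subst Min_gr_iff; auto)+
  moreover have "0 \<le> (MAX i\<in>{m..<n}. ?w i * ?v i)"
    using m by (subst Max_ge_iff) auto
  ultimately have "(MAX i\<in>{m..<n}. ?w i * ?v i) / (MIN i\<in>{..<k}. ?w i * ?v i)
     \<le> ((MAX i\<in>{m..<n}. ?w i) * (MAX i\<in>{m..<n}. ?v i)) / ((MIN i\<in>{..<k}. ?w i) * (MIN i\<in>{..<k}. ?v i))"
    using max min by (intro frac_le) auto
  moreover have "(MAX i\<in>{m..<n}. euclid_norm (row (block_krylov (mat_diag n f) W p) i))
      = (MAX i\<in>{m..<n}. ?w i * ?v i)"
    by (rule arg_cong[of _ _ Max], rule image_cong) (auto simp: eq)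
  moreover have "(MIN i\<in>{..<k}. euclid_norm (row (block_krylov (mat_diag n f) W p) i))
      = (MIN i\<in>{..<k}. ?w i * ?v i)"
    by (rule arg_cong[of _ _ Min], rule image_cong) (use k in \<open>auto simp: eq\<close>)
  ultimately show ?thesis
    using W by (simp add: Gamma_ratio_def block_krylov_def vandermonde_def)
qed

text \<open>Column 0 contains \<open>f i ^ 0 = 1\<close>, also when \<open>f i = 0\<close>.\<close>

lemma euclid_norm_row_vandermonde_pos:
  assumes "i < n"
  shows "0 < euclid_norm (row (vandermonde n p f) i)"
proof -
  have "row (vandermonde n p f) i $ 0 = 1"
    using assms by (simp add: vandermonde_def)
  moreover have "0 < dim_vec (row (vandermonde n p f) i)" by (simp add: vandermonde_def)
  ultimately have "euclid_norm (row (vandermonde n p f) i) \<noteq> 0"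
    unfolding euclid_norm_eq_0_iff by (metis index_zero_vec(1) zero_neq_one)
  then show ?thesis by (simp add: less_le)
qed

section \<open>Row normalisation and the estimate of delta\<close>

lemma normalised_rows_eq:
  assumes H: "H \<in> carrier_mat n r"
  shows "diag_pseudo_inverse (row_norm_diag H) * H
    = mat n r (\<lambda>(i, j). H $$ (i, j) / euclid_norm (row H i))"
proof -
  \<comment> \<open>The convention \<open>1 / 0 = 0\<close> absorbs the case distinction in
    \<open>diag_pseudo_inverse\<close>.\<close>
  have "diag_pseudo_inverse (row_norm_diag H) = mat_diag n (\<lambda>i. 1 / euclid_norm (row H i))"
    using H by (auto simp: diag_pseudo_inverse_def row_norm_diag_def mat_diag_def intro!: eq_matI)
  then show ?thesis
    by (simp only: mat_diag_mult_left[OF H]) simp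
qed

text \<open>This is how the G1-Assumption makes D_1 invertible: a zero row of \<open>H\<close> stays
  zero after normalisation, and independent rows are nonzero.\<close>

lemma normalised_rows_lin_indpt_imp_row_norm_pos:
  assumes H: "H \<in> carrier_mat n r" and m: "m \<le> n"
    and indpt: "rows_lin_indpt (first_rows m (diag_pseudo_inverse (row_norm_diag H) * H))"
    and i: "i < m"
  shows "0 < euclid_norm (row H i)"
proof (rule ccontr)
  assume "\<not> 0 < euclid_norm (row H i)"
  then have 0: "row H i = 0\<^sub>v (dim_col H)"
    using euclid_norm_nonneg[of "row H i"] euclid_norm_eq_0_iff[of "row H i"] by simp
  have "H $$ (i, j) = 0" if "j < r" for j
    using arg_cong[OF 0, of "\<lambda>v. v $ j"] that i m H by simp
  then have "row (first_rows m (diag_pseudo_inverse (row_norm_diag H) * H)) i = 0\<^sub>v r"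
    using i m H by (intro eq_vecI) (auto simp: first_rows_def normalised_rows_eq[OF H])
  then show False
    using rows_lin_indpt_row_nonzero[OF indpt, of i] i H by (simp add: first_rows_def)
qed

text \<open>The part of the argument free of eigenvalues and powers: \<open>H\<close> stands for
  Ghat, and \<open>QY\<close> is the only link between \<open>Y\<close> and
  \<open>H\<close>.\<close>

lemma delta_le_of_coordinates:
  fixes H Q Y P :: "real mat" and n r k m :: nat
  defines "G1 \<equiv> first_rows m (diag_pseudo_inverse (row_norm_diag H) * H)"
    and "D1 \<equiv> first_rows m (first_cols m (row_norm_diag H))"
  defines "P \<equiv> pseudo_inverse G1"
  assumes k: "0 < k" "k \<le> m" "m < n" and H: "H \<in> carrier_mat n r"
    and Q: "Q \<in> carrier_mat n n" and Y: "Y \<in> carrier_mat n k"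
    and indpt: "rows_lin_indpt G1"
    and QY: "transpose_mat Q * Y = first_cols k (H * P * the (mat_inverse D1))"
  shows "delta Q k Y \<le> Gamma_ratio k m H * spectral_norm (P * first_cols k (1\<^sub>m m))"
proof -
  define d where "d i = euclid_norm (row H i)" for i
  define M where "M = P * first_cols k (1\<^sub>m m)"
  have G1: "G1 \<in> carrier_mat m r" using H
    by (simp add: G1_def first_rows_def)
  have P: "P \<in> carrier_mat r m" and G1P: "G1 * P = 1\<^sub>m m"
    using mult_pseudo_inverse_right[OF G1 indpt] by (auto simp: P_def)
  have d_pos: "0 < d i" if "i < m" for i
    using normalised_rows_lin_indpt_imp_row_norm_pos[OF H _ indpt[unfolded G1_def] that] k
    by (simp add: d_def)
  have "D1 = mat_diag m d"
    using k H by (auto simp: D1_def first_rows_def first_cols_def row_norm_diag_def mat_diag_def d_def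
        intro!: eq_matI)
  then have D1_inv: "the (mat_inverse D1) = mat_diag m (\<lambda>i. 1 / d i)"
    using d_pos by (simp add: mat_inverse_diag less_imp_neq[symmetric])
  have HP: "H * P \<in> carrier_mat n m" using H P by auto
  have entry: "(transpose_mat Q * Y) $$ (i, j) = (row H i \<bullet> col P j) / d j" if "i < n" "j < k" for i j
    using that k H P unfolding QY D1_inv mat_diag_mult_right[OF HP] by (simp add: first_cols_def)
  have M: "M \<in> carrier_mat r k" using P k by (auto simp: M_def first_cols_def)
  have colM: "col M j = col P j" if "j < k" for j
  proof -
    have "M = first_cols k P" unfolding M_def using first_cols_mult[OF P one_carrier_mat k(2)] P by simp
    then show ?thesis using that P k by (auto simp: first_cols_def intro!: eq_vecI)
  qed
  \<comment> \<open>Undoing the normalisation of row i gives a factor \<open>d i\<close>, and D_1^-1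
    a factor \<open>1 / d j\<close>. As G_1 P is the identity, only i = j survives, where the two
    cancel.\<close>
  have row_low: "row (transpose_mat Q * Y) i = (if i < k then unit_vec k i else 0\<^sub>v k)" if i: "i < m" for i
  proof (rule eq_vecI)
    fix j assume "j < dim_vec (if i < k then unit_vec k i else 0\<^sub>v k)"
    then have j: "j < k" by (simp split: if_splits)
    have "row H i = d i \<cdot>\<^sub>v row G1 i"
      using i k H d_pos[OF i] unfolding d_def
      by (intro eq_vecI) (auto simp: G1_def first_rows_def normalised_rows_eq[OF H])
    then have "row H i \<bullet> col P j = d i * (G1 * P) $$ (i, j)"
      using i j k G1 P by simp
    then have "(transpose_mat Q * Y) $$ (i, j) = (if i = j then 1 else 0)"
      using i j k d_pos[of j] d_pos[of i] by (simp add: entry G1P)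
    then show "row (transpose_mat Q * Y) i $ j = (if i < k then unit_vec k i else 0\<^sub>v k) $ j"
      using i j k Q Y by auto
  qed (use Y in auto)
  have qnorm_low: "qnorm Q Y i = (if i < k then 1 else 0)" if "i < m" for i
    using that k qnorm_eq[OF Q Y, of i]
    by (simp add: row_low euclid_norm_unit_vec euclid_norm_def[of "0\<^sub>v k"])
  let ?\<mu> = "MIN i\<in>{..<k}. d i"
  have \<mu>: "0 < ?\<mu>" using k d_pos by (subst Min_gr_iff) auto
  \<comment> \<open>Replacing the divisors \<open>d j\<close> by their minimum dominates the row
    entrywise by a multiple of M^T applied to row i of \<open>H\<close>. The transposed spectral
    norm bound then applies, with \<open>d i\<close> as the norm of that row.\<close>
  have qnorm_high: "qnorm Q Y i \<le> spectral_norm M * d i / ?\<mu>" if i: "i < n" for i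
  proof -
    have "qnorm Q Y i \<le> euclid_norm ((1 / ?\<mu>) \<cdot>\<^sub>v (transpose_mat M *\<^sub>v row H i))"
      unfolding qnorm_eq[OF Q Y i]
    proof (rule euclid_norm_mono)
      fix j assume "j < dim_vec (row (transpose_mat Q * Y) i)"
      then have j: "j < k" using Y by simp
      have le: "?\<mu> \<le> d j" using j by (intro Min_le) auto
      have "(transpose_mat M *\<^sub>v row H i) $ j = row H i \<bullet> col P j"
        using j i M H comm_scalar_prod[of "col M j" r "row H i"] by (simp flip: colM)
      then show "\<bar>row (transpose_mat Q * Y) i $ j\<bar>
          \<le> \<bar>((1 / ?\<mu>) \<cdot>\<^sub>v (transpose_mat M *\<^sub>v row H i)) $ j\<bar>"
        using entry[OF i j] i j Q Y M \<mu> le abs_of_pos[OF less_le_trans[OF \<mu> le]]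
          frac_le[of "\<bar>row H i \<bullet> col P j\<bar>" _ ?\<mu> "d j"] by simp
    qed (use M Y in simp)
    also have "\<dots> = euclid_norm (transpose_mat M *\<^sub>v row H i) / ?\<mu>"
      using \<mu> by (simp add: euclid_norm_smult)
    also have "\<dots> \<le> spectral_norm M * d i / ?\<mu>"
      unfolding d_def
      by (intro divide_right_mono euclid_norm_transpose_mult_mat_vec_le)
        (use M H i \<mu> in \<open>auto simp: d_def intro!: carrier_vecI\<close>)
    finally show ?thesis .
  qed
  let ?\<nu> = "MAX i\<in>{m..<n}. d i"
  have \<nu>: "0 \<le> ?\<nu>" using k by (subst Max_ge_iff) (auto simp: d_def)
  have "(MIN i\<in>{..<k}. qnorm Q Y i) = (MIN i\<in>{..<k}. 1)"
    using k by (intro arg_cong[of _ _ Min] image_cong) (auto simp: qnorm_low)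
  also have "\<dots> = (1 :: real)" using k by (simp add: image_constant_conv lessThan_empty_iff)
  finally have min: "(MIN i\<in>{..<k}. qnorm Q Y i) = 1" .
  \<comment> \<open>The coordinates vanish for k <= i < m, so the maximum over
    \<open>{k..<n}\<close> is controlled by the one over \<open>{m..<n}\<close>.\<close>
  have "qnorm Q Y i \<le> ?\<nu> / ?\<mu> * spectral_norm M" if i: "i \<in> {k..<n}" for i
  proof (cases "i < m")
    case True
    then show ?thesis using i \<mu> \<nu> by (simp add: qnorm_low spectral_norm_nonneg)
  next
    case False
    then have "spectral_norm M * d i / ?\<mu> \<le> spectral_norm M * ?\<nu> / ?\<mu>"
      using i \<mu> by (intro divide_right_mono mult_left_mono Max_ge spectral_norm_nonneg) auto
    then show ?thesis using qnorm_high[of i] i by (simp add: mult.commute)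
  qed
  then have "(MAX i\<in>{k..<n}. qnorm Q Y i) \<le> ?\<nu> / ?\<mu> * spectral_norm M"
    using k by (subst Max_le_iff) auto
  then show ?thesis
    using Y H by (simp add: delta_def min Gamma_ratio_def d_def M_def)
qed

section \<open>Assembly of the two bounds\<close>

lemma transpose_mult_orthogonal_conj:
  fixes Q S :: "'a :: comm_ring_1 mat"
  assumes Q: "Q \<in> carrier_mat n n" "transpose_mat Q * Q = 1\<^sub>m n" and S: "S \<in> carrier_mat n n"
  shows "transpose_mat Q * (Q * S * transpose_mat Q) = S * transpose_mat Q"
proof -
  have QT: "transpose_mat Q \<in> carrier_mat n n" and ST: "S * transpose_mat Q \<in> carrier_mat n n"
    using Q S by auto
  have "transpose_mat Q * (Q * S * transpose_mat Q) = transpose_mat Q * (Q * (S * transpose_mat Q))"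
    by (simp only: assoc_mult_mat[OF Q(1) S QT])
  also have "\<dots> = (transpose_mat Q * Q) * (S * transpose_mat Q)"
    by (rule assoc_mult_mat[OF QT Q(1) ST, symmetric])
  also have "\<dots> = S * transpose_mat Q"
    unfolding Q(2) by (rule left_mult_one_mat[OF ST])
  finally show ?thesis .
qed

text \<open>The second estimate carries the nonvanishing of its own denominators as premises; for
  the first, the denominators are positive as a consequence of the G1-Assumption.\<close>

theorem theorem4p4:
  fixes n k p m q :: nat
    and A Q \<Lambda> rhoA X0 X V Xp Ghat D G D1 G1 Yp Y Ek :: "real mat"
    and lam :: "nat \<Rightarrow> real"
    and rho :: "real \<Rightarrow> real"
    and num den :: "real poly"
    and c c' :: real
  assumes "0 < k" and "(p + 1) * k < n"
    and "k \<le> m" and "m \<le> k + p * k"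
    and "0 < q"
    and A: "A \<in> carrier_mat n n" "transpose_mat A = A"
    and Q: "Q \<in> carrier_mat n n" "transpose_mat Q * Q = 1\<^sub>m n" "Q * transpose_mat Q = 1\<^sub>m n"
    and lam: "\<forall>i j. i \<le> j \<and> j < n \<longrightarrow> lam j \<le> lam i"
    and \<Lambda>: "\<Lambda> = mat_diag n lam"
    and eigen_decomposition: "A = Q * \<Lambda> * transpose_mat Q"
    and rho_defined: "\<forall>i < n. poly den (lam i) \<noteq> 0"
    and rho: "rho = (\<lambda>x. poly num x / poly den x)"
    and rho_min: "(MIN j \<in> {..<k}. \<bar>rho (lam j)\<bar>) = \<bar>rho (lam (k - 1))\<bar>"
    and rho_chain: "\<forall>j. k - 1 \<le> j \<and> j < m \<longrightarrow> \<bar>rho (lam (j + 1))\<bar> \<le> \<bar>rho (lam j)\<bar>"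
    and rho_max: "\<bar>rho (lam m)\<bar> = (MAX j \<in> {m..<n}. \<bar>rho (lam j)\<bar>)"
    and rhoA: "rhoA = Q * mat_diag n (\<lambda>i. rho (lam i)) * transpose_mat Q"
    and X0: "X0 \<in> carrier_mat n k"
    and X: "X = rhoA ^\<^sub>m q * X0"
    and V: "V = vandermonde n p lam"
    and Xp: "Xp = block_krylov A X p"
    and Ghat: "Ghat = block_krylov \<Lambda> (transpose_mat Q * X) p"
    and D: "D = row_norm_diag Ghat"
    and G: "G = diag_pseudo_inverse D * Ghat"
    and D1: "D1 = first_rows m (first_cols m D)"
    and G1: "G1 = first_rows m G"
    and G1_assumption: "rows_lin_indpt G1"
    and Yp: "Yp = Xp * pseudo_inverse G1 * the (mat_inverse D1)"
    and Y: "Y = first_cols k Yp"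
    and Ek: "Ek = first_cols k (1\<^sub>m m)"
    and c: "c = Gamma_ratio k m (transpose_mat Q * X0) * Gamma_ratio k m V
                * spectral_norm (pseudo_inverse G1 * Ek)"
    and c': "c' = (MAX j \<in> {m..<n}. qnorm Q X0 j) / (MIN j \<in> {k..<n}. qnorm Q X0 j)
                  * Gamma_ratio k m V * spectral_norm (pseudo_inverse G1 * Ek)"
  shows "delta Q k Y \<le> c * \<bar>rho (lam m) / rho (lam (k - 1))\<bar> ^ q \<and>
         ((MIN j \<in> {k..<n}. qnorm Q X0 j) \<noteq> 0 \<and> rho (lam k) \<noteq> 0 \<longrightarrow>
           delta Q k Y / delta Q k X \<le> c' * \<bar>rho (lam m) / rho (lam k)\<bar> ^ q)"
proof -
  define W where "W = transpose_mat Q * X"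
  define W0 where "W0 = transpose_mat Q * X0"
  define w where "w i = euclid_norm (row W i)" for i
  define w0 where "w0 i = euclid_norm (row W0 i)" for i
  define r where "r i = \<bar>rho (lam i)\<bar> ^ q" for i
  define N where "N = spectral_norm (pseudo_inverse G1 * Ek)"
  define P where "P = pseudo_inverse G1"
  define E where "E = the (mat_inverse D1)"
  \<comment> \<open>Hence \<open>{m..<n}\<close> and \<open>{k..<n}\<close> are nonempty and the
    maxima and minima over them are genuine.\<close>
  have mn: "m < n" using \<open>m \<le> k + p * k\<close> \<open>(p + 1) * k < n\<close> by simp
  note km = \<open>0 < k\<close> \<open>k \<le> m\<close>
  have QT: "transpose_mat Q \<in> carrier_mat n n" using Q by auto
  have rhoA_c: "rhoA \<in> carrier_mat n n" unfolding rhoA using QT Q by auto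
  have X_c: "X \<in> carrier_mat n k" unfolding X using rhoA_c X0 by auto
  have W_c: "W \<in> carrier_mat n k" and W0_c: "W0 \<in> carrier_mat n k"
    using QT X_c X0 by (auto simp: W_def W0_def)
  have qnorm_X: "qnorm Q X i = w i" and qnorm_X0: "qnorm Q X0 i = w0 i" if "i < n" for i
    using qnorm_eq[OF Q(1) X_c that] qnorm_eq[OF Q(1) X0 that]
    by (simp_all add: w_def w0_def W_def W0_def)

  \<comment> \<open>Q^T intertwines rho(A) with rho(Lambda), hence also their powers.\<close>
  have W_pow: "transpose_mat Q * rhoA ^\<^sub>m q = mat_diag n (\<lambda>i. rho (lam i)) ^\<^sub>m q * transpose_mat Q"
    unfolding rhoA using Q QT
    by (intro pow_mat_intertwine transpose_mult_orthogonal_conj) auto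
  have "W = transpose_mat Q * rhoA ^\<^sub>m q * X0"
    unfolding W_def X by (rule assoc_mult_mat[OF QT pow_carrier_mat[OF rhoA_c] X0, symmetric])
  also have "\<dots> = mat_diag n (\<lambda>i. rho (lam i) ^ q) * W0"
    unfolding W_pow mat_diag_pow W0_def by (rule assoc_mult_mat[OF mat_diag_dim QT X0])
  finally have W_eq: "W = mat_diag n (\<lambda>i. rho (lam i) ^ q) * W0" .
  have "row W i = rho (lam i) ^ q \<cdot>\<^sub>v row W0 i" if "i < n" for i
    using that W0_c unfolding W_eq by (intro eq_vecI) (auto simp: mat_diag_mult_left[OF W0_c])
  then have w_eq: "w i = r i * w0 i" if "i < n" for i
    using that by (simp add: w_def w0_def r_def euclid_norm_smult power_abs)

  have Ghat_eq: "Ghat = block_krylov (mat_diag n lam) W p"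
    by (simp add: Ghat \<Lambda> W_def)
  have Ghat_c: "Ghat \<in> carrier_mat n ((p + 1) * k)"
    using W_c by (simp add: Ghat_eq block_krylov_def)
  have "transpose_mat Q * A = \<Lambda> * transpose_mat Q"
    unfolding eigen_decomposition using Q by (intro transpose_mult_orthogonal_conj) (auto simp: \<Lambda>)
  then have QXp: "transpose_mat Q * Xp = Ghat"
    unfolding Xp Ghat
    using A QT X_c by (intro block_krylov_intertwine) (auto simp: \<Lambda>)
  have Xp_c: "Xp \<in> carrier_mat n ((p + 1) * k)"
    using X_c by (simp add: Xp block_krylov_def)
  have G1_c: "G1 \<in> carrier_mat m ((p + 1) * k)"
    using Ghat_c by (simp add: G1 first_rows_def G)
  have indpt: "rows_lin_indpt (first_rows m (diag_pseudo_inverse (row_norm_diag Ghat) * Ghat))"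
    using G1_assumption by (simp add: G1 G D)
  have P_c: "P \<in> carrier_mat ((p + 1) * k) m"
    unfolding P_def by (rule mult_pseudo_inverse_right(2)[OF G1_c G1_assumption])
  \<comment> \<open>Row i of \<open>Ghat\<close> has positive norm by the G1-Assumption, and this
    norm is \<open>w i\<close> times that of a Vandermonde row, so \<open>w i\<close> cannot
    vanish.\<close>
  have pos: "0 < w i" if "i < m" for i
    using normalised_rows_lin_indpt_imp_row_norm_pos[OF Ghat_c _ indpt that] that mn
      euclid_norm_row_block_krylov_diag[OF W_c, where i = i and p = p and f = lam] euclid_norm_nonneg[of "row W i"]
    by (auto simp: Ghat_eq w_def zero_less_mult_iff)
  \<comment> \<open>The dimensions of \<open>the (mat_inverse D1)\<close> are known only once D_1 is
    seen to be invertible.\<close>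
  have E_c: "E \<in> carrier_mat m m"
  proof -
    have "D1 = mat_diag m (\<lambda>i. euclid_norm (row Ghat i))"
      using mn Ghat_c by (auto simp: D1 D first_rows_def first_cols_def row_norm_diag_def
          mat_diag_def intro!: eq_matI)
    moreover have "euclid_norm (row Ghat i) \<noteq> 0" if "i < m" for i
      using normalised_rows_lin_indpt_imp_row_norm_pos[OF Ghat_c _ indpt that] mn by simp
    ultimately show ?thesis by (simp add: E_def mat_inverse_diag)
  qed
  have Yp_eq: "Yp = Xp * (P * E)"
    unfolding Yp P_def[symmetric] E_def[symmetric] by (rule assoc_mult_mat[OF Xp_c P_c E_c])
  have PE: "P * E \<in> carrier_mat ((p + 1) * k) m" using P_c E_c by auto
  then have Yp_c: "Yp \<in> carrier_mat n m" using Xp_c by (auto simp: Yp_eq)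
  have "transpose_mat Q * Y = first_cols k (transpose_mat Q * Yp)"
    unfolding Y by (rule first_cols_mult[OF QT Yp_c km(2)])
  also have "transpose_mat Q * Yp = (transpose_mat Q * Xp) * (P * E)"
    unfolding Yp_eq by (rule assoc_mult_mat[OF QT Xp_c PE, symmetric])
  also have "\<dots> = Ghat * P * E"
    unfolding QXp by (rule assoc_mult_mat[OF Ghat_c P_c E_c, symmetric])
  finally have QY: "transpose_mat Q * Y = first_cols k (Ghat * P * E)" .
  have Y_c: "Y \<in> carrier_mat n k" using Yp_c by (simp add: Y first_cols_def)
  have "delta Q k Y \<le> Gamma_ratio k m Ghat * N"
    unfolding N_def Ek G1 G D
    by (rule delta_le_of_coordinates[OF km mn Ghat_c Q(1) Y_c indpt])
      (use QY in \<open>simp add: P_def E_def G1 G D D1\<close>)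
  also have "Gamma_ratio k m Ghat \<le> Gamma_ratio k m W * Gamma_ratio k m V"
    unfolding Ghat_eq V using km mn pos
    by (intro Gamma_ratio_block_krylov[OF W_c]) (auto simp: w_def intro!: euclid_norm_row_vandermonde_pos)
  finally have main: "delta Q k Y \<le> Gamma_ratio k m W * (Gamma_ratio k m V * N)"
    by (simp add: N_def spectral_norm_nonneg mult_right_mono mult.assoc)
  have C: "0 \<le> Gamma_ratio k m V * N"
  proof -
    have "0 \<le> (MAX i\<in>{m..<n}. euclid_norm (row V i))" using mn by (subst Max_ge_iff) auto
    moreover have "0 \<le> (MIN i\<in>{..<k}. euclid_norm (row V i))" using km by (subst Min_ge_iff) auto
    moreover have "dim_row V = n" by (simp add: V vandermonde_def)
    ultimately show ?thesis by (simp add: Gamma_ratio_def N_def spectral_norm_nonneg)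
  qed

  let ?a = "MAX i\<in>{m..<n}. w i" and ?b = "MIN i\<in>{..<k}. w i" and ?a' = "MAX i\<in>{m..<n}. w0 i"
  have Gamma_W: "Gamma_ratio k m W = ?a / ?b"
    using W_c by (simp add: Gamma_ratio_def w_def)
  have w0_nonneg: "0 \<le> w0 i" for i by (simp add: w0_def)
  have r_nonneg: "0 \<le> r i" for i by (simp add: r_def)
  have b_pos: "0 < ?b" using km pos by (subst Min_gr_iff) auto
  have a_nonneg: "0 \<le> ?a" using mn by (subst Max_ge_iff) (auto simp: w_def)
  have a_le: "?a \<le> r m * ?a'"
  proof -
    have "w i \<le> r m * ?a'" if i: "i \<in> {m..<n}" for i
    proof -
      \<comment> \<open>With indices from 0, \<open>lam m\<close> is the eigenvalue lambda_{m+1},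
        where the tail attains its largest |rho|.\<close>
      have "\<bar>rho (lam i)\<bar> \<le> \<bar>rho (lam m)\<bar>" unfolding rho_max using i by (intro Max_ge) auto
      then have "r i \<le> r m" by (simp add: r_def power_mono)
      moreover have "w0 i \<le> ?a'" using i by (intro Max_ge) auto
      ultimately show ?thesis using i w_eq[of i] by (auto intro!: mult_mono simp: r_nonneg w0_nonneg)
    qed
    then show ?thesis using mn by (subst Max_le_iff) auto
  qed

  have "delta Q k Y \<le> c * \<bar>rho (lam m) / rho (lam (k - 1))\<bar> ^ q"
  proof -
    let ?b' = "MIN i\<in>{..<k}. w0 i"
    \<comment> \<open>Both factors of the positive \<open>w i\<close> are positive. In particular
      rho is nonzero at \<open>lam (k - 1)\<close>, and the denominator of
      \<open>Gamma_ratio k m W0\<close> is positive.\<close>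
    have prod_pos: "0 < r i \<and> 0 < w0 i" if "i < k" for i
      using pos[of i] that w_eq[of i] km mn r_nonneg[of i] w0_nonneg[of i]
      by (auto simp: zero_less_mult_iff)
    have b0_pos: "0 < ?b'" using km prod_pos by (subst Min_gr_iff) auto
    have "r (k - 1) * ?b' \<le> w i" if i: "i < k" for i
    proof -
      have "\<bar>rho (lam (k - 1))\<bar> \<le> \<bar>rho (lam i)\<bar>" unfolding rho_min[symmetric] using i by (intro Min_le) auto
      then have "r (k - 1) \<le> r i" by (simp add: r_def power_mono)
      moreover have "?b' \<le> w0 i" using i by (intro Min_le) auto
      ultimately show ?thesis
        using i w_eq[of i] km mn b0_pos by (auto intro!: mult_mono simp: r_nonneg)
    qed
    then have "r (k - 1) * ?b' \<le> ?b" using km by (subst Min_ge_iff) auto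
    then have "?a / ?b \<le> (r m * ?a') / (r (k - 1) * ?b')"
      using a_nonneg a_le b0_pos prod_pos[of "k - 1"] km by (intro frac_le) auto
    then have "delta Q k Y \<le> (r m * ?a') / (r (k - 1) * ?b') * (Gamma_ratio k m V * N)"
      by (intro order_trans[OF main[unfolded Gamma_W]] mult_right_mono C)
    also have "\<dots> = ?a' / ?b' * Gamma_ratio k m V * N * (r m / r (k - 1))"
      by (simp add: mult_ac)
    also have "?a' / ?b' = Gamma_ratio k m W0"
      using W0_c by (simp add: Gamma_ratio_def w0_def)
    also have "r m / r (k - 1) = \<bar>rho (lam m) / rho (lam (k - 1))\<bar> ^ q"
      by (simp add: r_def power_divide)
    finally show ?thesis by (simp add: c N_def W0_def)
  qed
  moreover have "delta Q k Y / delta Q k X \<le> c' * \<bar>rho (lam m) / rho (lam k)\<bar> ^ q"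
    if nz: "(MIN j \<in> {k..<n}. qnorm Q X0 j) \<noteq> 0" "rho (lam k) \<noteq> 0"
  proof -
    let ?e = "MAX i\<in>{k..<n}. w i" and ?e' = "MIN i\<in>{k..<n}. w0 i"
    have e0_eq: "(MIN i\<in>{k..<n}. qnorm Q X0 i) = ?e'"
      by (intro arg_cong[of _ _ Min] image_cong) (auto simp: qnorm_X0)
    have a0_eq: "(MAX i\<in>{m..<n}. qnorm Q X0 i) = ?a'"
      by (intro arg_cong[of _ _ Max] image_cong) (auto simp: qnorm_X0)
    have "0 \<le> ?e'" using km mn by (subst Min_ge_iff) (auto simp: w0_nonneg)
    then have e0_pos: "0 < ?e'" using nz(1) by (simp add: e0_eq)
    have rk: "0 < r k" using nz(2) by (simp add: r_def)
    \<comment> \<open>The single index \<open>k\<close>, that is lambda_{k+1}, already bounds the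
      numerator of delta(X) from below, which is why the rate has rho(lambda_{k+1}) as its
      denominator.\<close>
    have "r k * ?e' \<le> w k"
      using km mn w_eq[of k] by (auto intro!: mult_left_mono Min_le simp: r_nonneg)
    also have "w k \<le> ?e" using km mn by (intro Max_ge) auto
    finally have e_ge: "r k * ?e' \<le> ?e" .
    have e_pos: "0 < ?e" using less_le_trans[OF mult_pos_pos[OF rk e0_pos] e_ge] .
    have e_eq: "(MAX i\<in>{k..<n}. qnorm Q X i) = ?e"
      by (intro arg_cong[of _ _ Max] image_cong) (auto simp: qnorm_X)
    have b_eq: "(MIN i\<in>{..<k}. qnorm Q X i) = ?b"
      by (intro arg_cong[of _ _ Min] image_cong) (use km mn in \<open>auto simp: qnorm_X\<close>)
    have delta_X: "delta Q k X = ?e / ?b"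
      using X_c by (simp add: delta_def e_eq b_eq)
    \<comment> \<open>The bound \<open>main\<close>, still in terms of \<open>W\<close>, is used: it
      shares the denominator \<open>?b\<close> with delta(X), so the first \<open>k\<close> rows
      cancel before \<open>w\<close> is split into \<open>r\<close> and \<open>w0\<close>.\<close>
    have "delta Q k Y / delta Q k X \<le> ?a / ?b * (Gamma_ratio k m V * N) / (?e / ?b)"
      unfolding delta_X using main e_pos b_pos by (intro divide_right_mono) (auto simp: Gamma_W)
    also have "\<dots> = ?a / ?e * (Gamma_ratio k m V * N)"
      using b_pos by simp
    also have "\<dots> \<le> (r m * ?a') / (r k * ?e') * (Gamma_ratio k m V * N)"
      using a_nonneg a_le e_ge rk e0_pos C by (intro mult_right_mono frac_le) auto
    also have "\<dots> = ?a' / ?e' * Gamma_ratio k m V * N * (r m / r k)"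
      by (simp add: mult_ac)
    also have "r m / r k = \<bar>rho (lam m) / rho (lam k)\<bar> ^ q"
      by (simp add: r_def power_divide)
    finally show ?thesis by (simp add: c' e0_eq a0_eq N_def)
  qed
  ultimately show ?thesis by blast
qed

end
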